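(* Let $1<p<\infty$ and let $\Gamma$ be a set. Every closed subspace $X$ of $\ell_p(\Gamma)$ has the form $X=\ell_p(\mathscr J, X_J)$, where $\mathscr J$ is a decomposition of $\Gamma$ into (pairwise disjoint) countable subsets and $X_J$ is a subspace of $\ell_p(J)$ for every $J\in\mathscr J$.
   Context: Scalars are real. $\ell_p(\Gamma)$ is the space of functions $x:\Gamma\to\mathbb R$ with $\|x\|_p=\left(\sum_{i\in\Gamma}|x(i)|^p\right)^{1/p}<\infty$. For $J\subset\Gamma$, $\ell_p(J)$ is regarded as the subspace of those elements of $\ell_p(\Gamma)$ that vanish off $J$. "Countable" means finite or countably infinite. If $\mathscr J$ is a family of pairwise disjoint subsets of $\Gamma$ and $X_J\subset\ell_p(J)$ is a subspace for each $J\in\mathscr J$, then $$\ell_p(\mathscr J,X_J)=\left\{x\in\ell_p(\Gamma): \operatorname{supp}x\subset\bigcup\mathscr J \text{ and } x1_J\in X_J \text{ for all } J\in\mathscr J\right\},$$ where $x1_J$ is the pointwise product of $x$ with the characteristic function of $J$. The equality $X=\ell_p(\mathscr J,X_J)$ is an equality of subsets of $\ell_p(\Gamma)$. *)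

theory Defs
  imports "HOL-Analysis.Analysis" "HOL-Library.Function_Algebras"
begin

text \<open>
  The space \<open>\<ell>\<^sub>p(\<Gamma>)\<close> over a set \<open>\<Gamma> :: 'a set\<close>. A function on \<open>\<Gamma>\<close> is represented by its
  extension by zero to the whole type. With this convention, \<open>lp p J\<close> for \<open>J \<subseteq> \<Gamma>\<close> is literally
  the subset of those elements of \<open>lp p \<Gamma>\<close> that vanish off \<open>J\<close> (lemma \<open>lp_subset_eq\<close>).
\<close>

definition lp :: "real \<Rightarrow> 'a set \<Rightarrow> ('a \<Rightarrow> real) set" where
  "lp p \<Gamma> = {x. (\<forall>i. i \<notin> \<Gamma> \<longrightarrow> x i = 0) \<and> (\<lambda>i. \<bar>x i\<bar> powr p) summable_on \<Gamma>}"

definition lp_norm :: "real \<Rightarrow> 'a set \<Rightarrow> ('a \<Rightarrow> real) \<Rightarrow> real" where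
  "lp_norm p \<Gamma> x = (\<Sum>\<^sub>\<infinity>i\<in>\<Gamma>. \<bar>x i\<bar> powr p) powr (1 / p)"

text \<open>
  The norm topology. \<open>Metric_space.mtopology\<close> has the intended meaning for \<open>p \<ge> 1\<close>, by
  lemma \<open>Metric_space_lp\<close>.
\<close>

definition lp_topology :: "real \<Rightarrow> 'a set \<Rightarrow> ('a \<Rightarrow> real) topology" where
  "lp_topology p \<Gamma> = Metric_space.mtopology (lp p \<Gamma>) (\<lambda>x y. lp_norm p \<Gamma> (x - y))"

global_interpretation fun_space: vector_space "\<lambda>(c::real) (x::'a \<Rightarrow> real) i. c * x i"
  by unfold_locales (auto simp: fun_eq_iff algebra_simps)

definition lp_sum ::
    "real \<Rightarrow> 'a set \<Rightarrow> 'a set set \<Rightarrow> ('a set \<Rightarrow> ('a \<Rightarrow> real) set) \<Rightarrow> ('a \<Rightarrow> real) set" where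
  "lp_sum p \<Gamma> \<J> X = {x \<in> lp p \<Gamma>. {i. x i \<noteq> 0} \<subseteq> \<Union>\<J> \<and>
     (\<forall>J\<in>\<J>. (\<lambda>i. x i * indicator J i) \<in> X J)}"

lemma lp_subset_eq:
  assumes "J \<subseteq> \<Gamma>"
  shows "lp p J = {x \<in> lp p \<Gamma>. \<forall>i. i \<notin> J \<longrightarrow> x i = 0}"
proof -
  have "(\<lambda>i. \<bar>x i\<bar> powr p) summable_on \<Gamma> \<longleftrightarrow> (\<lambda>i. \<bar>x i\<bar> powr p) summable_on J"
    if "\<forall>i. i \<notin> J \<longrightarrow> x i = 0" for x :: "'a \<Rightarrow> real"
    using assms that by (intro summable_on_cong_neutral) auto
  then show ?thesis using assms by (auto simp: lp_def)
qed

lemma powr_add_le_weighted: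
  fixes s t a b p :: real
  assumes "p \<ge> 1" "s \<ge> 0" "t \<ge> 0" "a > 0" "b > 0"
  shows "(s + t) powr p \<le> (a + b) powr (p - 1) * (a powr (1 - p) * s powr p + b powr (1 - p) * t powr p)"
proof -
  have one: "u powr p \<le> (c + d) powr (p - 1) * (c powr (1 - p) * u powr p)"
    if "c > 0" "d > 0" "u \<ge> 0" for c d u :: real
  proof -
    have "c powr (p - 1) \<le> (c + d) powr (p - 1)" using that assms by (intro powr_mono2) auto
    then have "c powr (p - 1) * c powr (1 - p) \<le> (c + d) powr (p - 1) * c powr (1 - p)"
      by (intro mult_right_mono) auto
    moreover have "c powr (p - 1) * c powr (1 - p) = 1"
      using that by (simp flip: powr_add)
    ultimately have "1 * u powr p \<le> ((c + d) powr (p - 1) * c powr (1 - p)) * u powr p"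
      by (intro mult_right_mono) auto
    then show ?thesis by (simp add: mult.assoc)
  qed
  consider "s = 0" | "t = 0" | "s > 0" "t > 0" using assms by linarith
  then show ?thesis
  proof cases
    case 1
    then show ?thesis using one[of b a t] assms by (simp add: add.commute)
  next
    case 2
    then show ?thesis using one[of a b s] assms by simp
  next
    case 3
    define w where "w = b / (a + b)"
    have l: "0 \<le> w" "w \<le> 1" "1 - w = a / (a + b)"
      using assms by (auto simp: w_def field_simps)
    have "((1 - w) *\<^sub>R (s / a) + w *\<^sub>R (t / b)) powr p
        \<le> (1 - w) * (s / a) powr p + w * (t / b) powr p"
      using convex_onD[OF powr_convex[OF assms(1)], of w "s / a" "t / b"] l 3 assms by auto
    moreover have "(1 - w) *\<^sub>R (s / a) + w *\<^sub>R (t / b) = (s + t) / (a + b)"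
      using assms by (simp add: l(3)) (simp add: w_def add_divide_distrib)
    ultimately have "((s + t) / (a + b)) powr p
        \<le> a / (a + b) * (s / a) powr p + b / (a + b) * (t / b) powr p"
      by (simp add: l(3)) (simp add: w_def)
    then have "(a + b) powr p * ((s + t) / (a + b)) powr p
        \<le> (a + b) powr p * (a / (a + b) * (s / a) powr p + b / (a + b) * (t / b) powr p)"
      by (intro mult_left_mono) auto
    moreover have "(a + b) powr p * ((s + t) / (a + b)) powr p = (s + t) powr p"
      using assms by (simp add: powr_divide)
    moreover have "(a + b) powr p * (a / (a + b) * (s / a) powr p + b / (a + b) * (t / b) powr p)
        = (a + b) powr (p - 1) * (a powr (1 - p) * s powr p + b powr (1 - p) * t powr p)"
    proof -
      have "(a + b) powr p * (c / (a + b) * (u / c) powr p)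
          = (a + b) powr (p - 1) * (c powr (1 - p) * u powr p)" if "c > 0" "u > 0" for c u
        using assms that by (simp add: powr_divide powr_diff)
      from this[of a s] this[of b t] show ?thesis
        using assms 3 by (simp add: distrib_left)
    qed
    ultimately show ?thesis by simp
  qed
qed

lemma lp_norm_nonneg [simp]: "lp_norm p \<Gamma> x \<ge> 0"
  by (simp add: lp_norm_def)

lemma lp_norm_powr:
  assumes "p \<ge> 1"
  shows "lp_norm p \<Gamma> x powr p = (\<Sum>\<^sub>\<infinity>i\<in>\<Gamma>. \<bar>x i\<bar> powr p)"
  using assms by (simp add: lp_norm_def powr_powr infsum_nonneg)

lemma lp_norm_eq_0_iff:
  assumes "p \<ge> 1" "x \<in> lp p \<Gamma>"
  shows "lp_norm p \<Gamma> x = 0 \<longleftrightarrow> x = 0"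
proof
  assume "lp_norm p \<Gamma> x = 0"
  then have "(\<Sum>\<^sub>\<infinity>i\<in>\<Gamma>. \<bar>x i\<bar> powr p) \<le> 0" by (simp add: lp_norm_def)
  then have "\<bar>x i\<bar> powr p = 0" if "i \<in> \<Gamma>" for i
    using assms that by (intro nonneg_infsum_le_0D[of "\<lambda>i. \<bar>x i\<bar> powr p" \<Gamma>]) (auto simp: lp_def)
  then show "x = 0" using assms by (auto simp: lp_def fun_eq_iff)
qed (simp add: lp_norm_def)

lemma lp_add_norm_le:
  assumes p: "p \<ge> 1" and x: "x \<in> lp p \<Gamma>" and y: "y \<in> lp p \<Gamma>"
  shows "x + y \<in> lp p \<Gamma>" "lp_norm p \<Gamma> (x + y) \<le> lp_norm p \<Gamma> x + lp_norm p \<Gamma> y"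
proof -
  define a b where "a = lp_norm p \<Gamma> x" and "b = lp_norm p \<Gamma> y"
  have *: "x + y \<in> lp p \<Gamma> \<and> lp_norm p \<Gamma> (x + y) \<le> a + b"
  proof (cases "x = 0 \<or> y = 0")
    case True
    then show ?thesis using x y by (auto simp: a_def b_def)
  next
    case False
    then have ab: "a > 0" "b > 0"
      using lp_norm_eq_0_iff[OF p x] lp_norm_eq_0_iff[OF p y]
      by (auto simp: a_def b_def less_le)
    let ?g = "\<lambda>i. (a + b) powr (p - 1) *
      (a powr (1 - p) * \<bar>x i\<bar> powr p + b powr (1 - p) * \<bar>y i\<bar> powr p)"
    have sx: "(\<lambda>i. \<bar>x i\<bar> powr p) summable_on \<Gamma>" and sy: "(\<lambda>i. \<bar>y i\<bar> powr p) summable_on \<Gamma>"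
      using x y by (auto simp: lp_def)
    have g: "(?g has_sum ((a + b) powr (p - 1) *
        (a powr (1 - p) * a powr p + b powr (1 - p) * b powr p))) \<Gamma>"
      using sx sy unfolding a_def b_def lp_norm_powr[OF p]
      by (intro has_sum_cmult_right has_sum_add has_sum_infsum)
    have le: "\<bar>(x + y) i\<bar> powr p \<le> ?g i" for i
    proof -
      have "\<bar>(x + y) i\<bar> powr p \<le> (\<bar>x i\<bar> + \<bar>y i\<bar>) powr p"
        using p by (intro powr_mono2) auto
      also have "\<dots> \<le> ?g i" using p ab by (intro powr_add_le_weighted) auto
      finally show ?thesis .
    qed
    have s: "(\<lambda>i. \<bar>(x + y) i\<bar> powr p) summable_on \<Gamma>"
      by (rule summable_on_comparison_test[OF has_sum_imp_summable[OF g]]) (use le in auto)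
    have "(\<Sum>\<^sub>\<infinity>i\<in>\<Gamma>. \<bar>(x + y) i\<bar> powr p) \<le> (\<Sum>\<^sub>\<infinity>i\<in>\<Gamma>. ?g i)"
      using s has_sum_imp_summable[OF g] le by (rule infsum_mono)
    also have "\<dots> = (a + b) powr (p - 1) * (a powr (1 - p) * a powr p + b powr (1 - p) * b powr p)"
      using g by (rule infsumI)
    also have "\<dots> = (a + b) powr (p - 1) * (a + b) powr 1"
      using ab by (simp flip: powr_add)
    also have "\<dots> = (a + b) powr p" by (subst powr_add[symmetric]) simp
    finally have "lp_norm p \<Gamma> (x + y) \<le> ((a + b) powr p) powr (1 / p)"
      unfolding lp_norm_def using p by (intro powr_mono2) (auto intro: infsum_nonneg)
    also have "\<dots> = a + b" using ab p by (simp add: powr_powr)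
    finally show ?thesis using s x y by (auto simp: lp_def)
  qed
  then show "x + y \<in> lp p \<Gamma>" "lp_norm p \<Gamma> (x + y) \<le> lp_norm p \<Gamma> x + lp_norm p \<Gamma> y"
    by (auto simp: a_def b_def)
qed

lemma lp_diff:
  assumes "p \<ge> 1" "x \<in> lp p \<Gamma>" "y \<in> lp p \<Gamma>"
  shows "x - y \<in> lp p \<Gamma>"
proof -
  have "- y \<in> lp p \<Gamma>" using assms by (auto simp: lp_def)
  then show ?thesis using lp_add_norm_le(1)[OF assms(1,2), of "- y"] by simp
qed

lemma Metric_space_lp:
  assumes "p \<ge> 1"
  shows "Metric_space (lp p \<Gamma>) (\<lambda>x y. lp_norm p \<Gamma> (x - y))"
proof
  fix x y :: "'a \<Rightarrow> real"
  show "lp_norm p \<Gamma> (x - y) = lp_norm p \<Gamma> (y - x)"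
    by (simp add: lp_norm_def abs_minus_commute)
  assume "x \<in> lp p \<Gamma>" "y \<in> lp p \<Gamma>"
  then show "lp_norm p \<Gamma> (x - y) = 0 \<longleftrightarrow> x = y"
    using assms by (simp add: lp_norm_eq_0_iff lp_diff)
next
  fix x y z assume "x \<in> lp p \<Gamma>" "y \<in> lp p \<Gamma>" "z \<in> lp p \<Gamma>"
  then show "lp_norm p \<Gamma> (x - z) \<le> lp_norm p \<Gamma> (x - y) + lp_norm p \<Gamma> (y - z)"
    using lp_add_norm_le(2)[OF assms, of "x - y" \<Gamma> "y - z"] assms by (simp add: lp_diff)
qed simp

end

theory Submission
  imports Defs
begin

text \<open>
  Call \<open>K\<close> reducing if \<open>x1\<^sub>K \<in> X\<close> for all \<open>x \<in> X\<close>. Reducing sets are closed under complements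
  and, as \<open>X\<close> is closed, under arbitrary intersections; hence the smallest reducing sets
  containing a given point partition \<open>\<Gamma>\<close>. They are countable because every countable \<open>J\<^sub>0\<close> lies
  in a countable reducing set: a closing-off argument gives a countable \<open>J \<supseteq> J\<^sub>0\<close> such that every
  \<open>y \<in> \<ell>\<^sub>p(J)\<close> has the same distance to \<open>X\<close> as to \<open>X \<inter> \<ell>\<^sub>p(J)\<close>. For \<open>x \<in> X\<close> and \<open>y = x1\<^sub>J\<close> this
  distance is \<open>0\<close>, because otherwise a near-best approximation \<open>z \<in> X \<inter> \<ell>\<^sub>p(J)\<close> of \<open>y\<close> is
  improved by \<open>(1 - t) z + t x\<close> for small \<open>t > 0\<close>.
\<close>

section \<open>Tails, domination and supports in \<open>lp\<close>\<close>

lemma summable_on_tail_small: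
  fixes f :: "'a \<Rightarrow> real"
  assumes "f summable_on S" "\<epsilon> > 0"
  obtains A where "finite A" "A \<subseteq> S" "infsum f (S - A) < \<epsilon>"
proof -
  have "(sum f \<longlongrightarrow> infsum f S) (finite_subsets_at_top S)"
    using has_sum_infsum[OF assms(1)] by (simp add: has_sum_def)
  then have "eventually (\<lambda>A. dist (sum f A) (infsum f S) < \<epsilon>) (finite_subsets_at_top S)"
    using assms(2) by (rule tendstoD)
  then obtain A where A: "finite A" "A \<subseteq> S" "dist (sum f A) (infsum f S) < \<epsilon>"
    unfolding eventually_finite_subsets_at_top by blast
  have "infsum f (S - A) = infsum f S - infsum f A"
    using assms(1) A by (intro infsum_Diff) auto
  then have "infsum f (S - A) < \<epsilon>"
    using A by (simp add: dist_real_def abs_if split: if_splits)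
  then show ?thesis using A that by blast
qed

lemma lp_powr_summable: "x \<in> lp p S \<Longrightarrow> (\<lambda>i. \<bar>x i\<bar> powr p) summable_on S"
  by (simp add: lp_def)

lemma lp_dominated:
  assumes "x \<in> lp p S" "p \<ge> 0" "\<And>i. \<bar>y i\<bar> \<le> \<bar>x i\<bar>"
  shows "y \<in> lp p S"
proof -
  have "(\<lambda>i. \<bar>y i\<bar> powr p) summable_on S"
    using lp_powr_summable[OF assms(1)]
    by (rule summable_on_comparison_test) (use assms in \<open>auto intro: powr_mono2\<close>)
  moreover have "y i = 0" if "i \<notin> S" for i
    using assms(1) assms(3)[of i] that by (simp add: lp_def)
  ultimately show ?thesis by (simp add: lp_def)
qed

lemma lp_restrict: "x \<in> lp p S \<Longrightarrow> p \<ge> 0 \<Longrightarrow> (\<lambda>i. x i * indicator K i) \<in> lp p S"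
  by (erule lp_dominated) (auto simp: indicator_def)

text \<open>A summable family has only countably many nonzero terms. This keeps the closing-off
  argument countable when supports of elements of \<open>X\<close> are added.\<close>

lemma lp_countable_support:
  assumes "x \<in> lp p S"
  shows "countable {i. x i \<noteq> 0}"
proof -
  have "countable {i \<in> S. \<bar>x i\<bar> powr p \<noteq> 0}"
    using lp_powr_summable[OF assms] by (intro abs_summable_countable) simp
  moreover have "{i. x i \<noteq> 0} = {i \<in> S. \<bar>x i\<bar> powr p \<noteq> 0}"
    using assms by (auto simp: lp_def)
  ultimately show ?thesis by simp
qed

section \<open>A countable dense set of rational vectors\<close>

text \<open>Written as a union over the finite supports \<open>A\<close>, so that countability
  reduces to a countable union of countable sets.\<close>

definition rational_vectors :: "'a set \<Rightarrow> ('a \<Rightarrow> real) set" where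
  "rational_vectors J = (\<Union>A\<in>{A. A \<subseteq> J \<and> finite A}. {a. (\<forall>i. a i \<in> \<rat>) \<and> (\<forall>i. i \<notin> A \<longrightarrow> a i = 0)})"

lemma countable_rational_vectors:
  assumes "countable J"
  shows "countable (rational_vectors J)"
proof -
  have "countable {a::'a \<Rightarrow> real. (\<forall>i. a i \<in> \<rat>) \<and> (\<forall>i. i \<notin> A \<longrightarrow> a i = 0)}"
    if "finite A" for A :: "'a set"
  proof (rule countable_subset)
    \<comment> \<open>Members of the extensional function space are \<open>undefined\<close> off
      \<open>A\<close>; the map replaces that value by zero.\<close>
    show "{a::'a \<Rightarrow> real. (\<forall>i. a i \<in> \<rat>) \<and> (\<forall>i. i \<notin> A \<longrightarrow> a i = 0)}
        \<subseteq> (\<lambda>b i. if i \<in> A then b i else 0) ` (A \<rightarrow>\<^sub>E \<rat>)"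
    proof
      fix a :: "'a \<Rightarrow> real" assume "a \<in> {a. (\<forall>i. a i \<in> \<rat>) \<and> (\<forall>i. i \<notin> A \<longrightarrow> a i = 0)}"
      then have "a = (\<lambda>b i. if i \<in> A then b i else 0) (restrict a A)" "restrict a A \<in> A \<rightarrow>\<^sub>E \<rat>"
        by (auto simp: fun_eq_iff)
      then show "a \<in> (\<lambda>b i. if i \<in> A then b i else 0) ` (A \<rightarrow>\<^sub>E \<rat>)" by blast
    qed
    show "countable ((\<lambda>b i. if i \<in> A then b i else 0) ` (A \<rightarrow>\<^sub>E (\<rat>::real set)))"
      using that by (intro countable_image countable_PiE countable_rat)
  qed
  moreover have "countable {A. A \<subseteq> J \<and> finite A}"
    using countable_Collect_finite_subset[OF assms] by (simp add: conj_commute)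
  ultimately show ?thesis unfolding rational_vectors_def by (intro countable_UN) auto
qed

text \<open>A finite support inside the union of an increasing chain already lies in one stage.
  Hence countably many rounds of closing off suffice.\<close>

lemma rational_vectors_UN_incseq:
  assumes "incseq J"
  shows "rational_vectors (\<Union>n. J n) \<subseteq> (\<Union>n::nat. rational_vectors (J n))"
proof
  fix a assume "a \<in> rational_vectors (\<Union>n. J n)"
  then obtain A where A: "finite A" "A \<subseteq> (\<Union>n. J n)" "\<forall>i. a i \<in> \<rat>" "\<forall>i. i \<notin> A \<longrightarrow> a i = 0"
    by (auto simp: rational_vectors_def)
  have "\<exists>n. A \<subseteq> J n" using A(1,2)
  proof (induction A rule: finite_induct)
    case (insert b B)
    then obtain m n where "B \<subseteq> J m" "b \<in> J n" by blast
    moreover have "J m \<subseteq> J (max m n)" "J n \<subseteq> J (max m n)"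
      using assms by (simp_all add: incseqD)
    ultimately have "insert b B \<subseteq> J (max m n)" by blast
    then show ?case by blast
  qed simp
  then show "a \<in> (\<Union>n. rational_vectors (J n))" using A by (auto simp: rational_vectors_def)
qed

lemma rational_vectors_subset_lp: "rational_vectors J \<subseteq> lp p J"
proof
  fix a assume "a \<in> rational_vectors J"
  then obtain A where A: "finite A" "A \<subseteq> J" "\<And>i. i \<notin> A \<Longrightarrow> a i = 0"
    by (auto simp: rational_vectors_def)
  have "(\<lambda>i. \<bar>a i\<bar> powr p) summable_on J \<longleftrightarrow> (\<lambda>i. \<bar>a i\<bar> powr p) summable_on A"
    using A by (intro summable_on_cong_neutral) auto
  then show "a \<in> lp p J" using A by (auto simp: lp_def)
qed

lemma lp_norm_less_iff:
  assumes "p \<ge> 1" "\<epsilon> > 0"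
  shows "lp_norm p \<Gamma> x < \<epsilon> \<longleftrightarrow> (\<Sum>\<^sub>\<infinity>i\<in>\<Gamma>. \<bar>x i\<bar> powr p) < \<epsilon> powr p"
proof -
  have "lp_norm p \<Gamma> x powr p < \<epsilon> powr p" if "lp_norm p \<Gamma> x < \<epsilon>"
    using assms that by (intro powr_less_mono2) auto
  moreover have "\<epsilon> powr p \<le> lp_norm p \<Gamma> x powr p" if "\<epsilon> \<le> lp_norm p \<Gamma> x"
    using assms that by (intro powr_mono2) auto
  ultimately show ?thesis
    unfolding lp_norm_powr[OF assms(1), symmetric] by (meson not_less)
qed

text \<open>Half of \<open>\<epsilon> powr p\<close> pays for the tail of \<open>x\<close> off a
  finite set \<open>A\<close>, the other half for rational approximation of the coordinates in
  \<open>A\<close>.\<close>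

lemma rational_vectors_dense:
  assumes p: "p \<ge> 1" and J: "J \<subseteq> \<Gamma>" and x: "x \<in> lp p J" and \<epsilon>: "\<epsilon> > 0"
  obtains a where "a \<in> rational_vectors J" "lp_norm p \<Gamma> (x - a) < \<epsilon>"
proof -
  define \<delta> where "\<delta> = \<epsilon> powr p / 2"
  have \<delta>: "\<delta> > 0" "2 * \<delta> = \<epsilon> powr p" using \<epsilon> by (auto simp: \<delta>_def)
  obtain A where A: "finite A" "A \<subseteq> J" and tail: "(\<Sum>\<^sub>\<infinity>i\<in>J - A. \<bar>x i\<bar> powr p) < \<delta>"
    using summable_on_tail_small[OF lp_powr_summable[OF x] \<delta>(1)] by blast
  \<comment> \<open>Chosen so that \<open>card A\<close> errors of size \<open>\<eta> powr p\<close>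
    add up to at most \<open>\<delta>\<close>; the summand 1 keeps \<open>\<eta>\<close> positive
    when \<open>A\<close> is empty.\<close>
  define \<eta> where "\<eta> = (\<delta> / (card A + 1)) powr (1 / p)"
  have \<eta>: "\<eta> > 0" "\<eta> powr p = \<delta> / (card A + 1)"
    using \<delta> p by (auto simp: \<eta>_def powr_powr)
  have "\<exists>q\<in>\<rat>. \<bar>x i - q\<bar> < \<eta>" for i
  proof -
    obtain q where "q \<in> \<rat>" "x i - \<eta> < q" "q < x i + \<eta>"
      using Rats_dense_in_real[of "x i - \<eta>" "x i + \<eta>"] \<eta>(1) by auto
    then show ?thesis by (intro bexI[of _ q]) (auto simp: abs_less_iff)
  qed
  then obtain q where q: "\<And>i. q i \<in> \<rat>" "\<And>i. \<bar>x i - q i\<bar> < \<eta>" by metis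
  define a where "a i = (if i \<in> A then q i else 0)" for i
  have a: "a \<in> rational_vectors J"
    using A q(1) by (auto simp: rational_vectors_def a_def)
  have "x - a \<in> lp p J"
    using lp_diff[OF p x] a rational_vectors_subset_lp by blast
  then have s: "(\<lambda>i. \<bar>(x - a) i\<bar> powr p) summable_on J" by (rule lp_powr_summable)
  have "(\<Sum>\<^sub>\<infinity>i\<in>\<Gamma>. \<bar>(x - a) i\<bar> powr p) = (\<Sum>\<^sub>\<infinity>i\<in>J. \<bar>(x - a) i\<bar> powr p)"
    using J A x by (intro infsum_cong_neutral) (auto simp: lp_def a_def)
  also have "\<dots> = (\<Sum>\<^sub>\<infinity>i\<in>(J - A) \<union> A. \<bar>(x - a) i\<bar> powr p)"
    using A by (intro arg_cong2[where f = infsum]) auto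
  also have "\<dots> = (\<Sum>\<^sub>\<infinity>i\<in>J - A. \<bar>(x - a) i\<bar> powr p) + (\<Sum>i\<in>A. \<bar>(x - a) i\<bar> powr p)"
    using A summable_on_subset_banach[OF s, of "J - A"] by (subst infsum_Un_disjoint) auto
  also have "(\<Sum>\<^sub>\<infinity>i\<in>J - A. \<bar>(x - a) i\<bar> powr p) = (\<Sum>\<^sub>\<infinity>i\<in>J - A. \<bar>x i\<bar> powr p)"
    by (intro infsum_cong) (auto simp: a_def)
  also have "(\<Sum>i\<in>A. \<bar>(x - a) i\<bar> powr p) \<le> (\<Sum>i\<in>A. \<eta> powr p)"
    using q(2) p by (intro sum_mono powr_mono2) (auto simp: a_def less_imp_le)
  also have "\<dots> \<le> \<delta>" using \<delta> by (simp add: \<eta>(2) field_simps)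
  finally have "(\<Sum>\<^sub>\<infinity>i\<in>\<Gamma>. \<bar>(x - a) i\<bar> powr p) < \<epsilon> powr p" using tail \<delta>(2) by linarith
  then show ?thesis using that[OF a] lp_norm_less_iff[OF p \<epsilon>] by blast
qed

section \<open>Membership in a closed set by approximation\<close>

lemma closed_lp_memI:
  assumes p: "p \<ge> 1" and X: "X \<subseteq> lp p \<Gamma>" "closedin (lp_topology p \<Gamma>) X"
    and u: "u \<in> lp p \<Gamma>" and w: "\<And>\<epsilon>. \<epsilon> > 0 \<Longrightarrow> \<exists>w\<in>X. lp_norm p \<Gamma> (u - w) < \<epsilon>"
  shows "u \<in> X"
proof -
  interpret Metric_space "lp p \<Gamma>" "\<lambda>x y. lp_norm p \<Gamma> (x - y)" using p by (rule Metric_space_lp)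
  have "closedin mtopology X" using X(2) by (simp add: lp_topology_def)
  show ?thesis
  proof (rule ccontr)
    assume "u \<notin> X"
    then obtain r where r: "r > 0" "disjnt X (mball u r)"
      using \<open>closedin mtopology X\<close> u unfolding closedin_metric by blast
    obtain v where "v \<in> X" "lp_norm p \<Gamma> (u - v) < r" using w[OF r(1)] by blast
    then have "v \<in> X \<inter> mball u r" using X u by auto
    then show False using r by (auto simp: disjnt_def)
  qed
qed

text \<open>Choose \<open>A\<close> so that the tail of \<open>x\<close> off \<open>A\<close> is
  small. The error \<open>u - w\<close> vanishes on \<open>A\<close> and is dominated by
  \<open>x\<close> elsewhere, so its norm is small. Thus, under a fixed dominating function,
  agreement on finite sets replaces norm convergence.\<close>

lemma closed_lp_memI_finite:
  assumes p: "p \<ge> 1" and X: "X \<subseteq> lp p \<Gamma>" "closedin (lp_topology p \<Gamma>) X"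
    and u: "u \<in> lp p \<Gamma>" and x: "x \<in> lp p \<Gamma>"
    and w: "\<And>A. finite A \<Longrightarrow> A \<subseteq> \<Gamma> \<Longrightarrow> \<exists>w\<in>X. (\<forall>i\<in>A. w i = u i) \<and> (\<forall>i. \<bar>u i - w i\<bar> \<le> \<bar>x i\<bar>)"
  shows "u \<in> X"
proof (rule closed_lp_memI[OF p X u])
  fix \<epsilon> :: real assume \<epsilon>: "\<epsilon> > 0"
  then have "\<epsilon> powr p > 0" by simp
  then obtain A where A: "finite A" "A \<subseteq> \<Gamma>" and tail: "(\<Sum>\<^sub>\<infinity>i\<in>\<Gamma> - A. \<bar>x i\<bar> powr p) < \<epsilon> powr p"
    using summable_on_tail_small[OF lp_powr_summable[OF x]] by blast
  obtain w where wX: "w \<in> X" and eq: "\<And>i. i \<in> A \<Longrightarrow> w i = u i" and le: "\<And>i. \<bar>u i - w i\<bar> \<le> \<bar>x i\<bar>"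
    using w[OF A] by blast
  have "u - w \<in> lp p \<Gamma>" using lp_diff[OF p u] wX X by blast
  then have s: "(\<lambda>i. \<bar>(u - w) i\<bar> powr p) summable_on \<Gamma>" by (rule lp_powr_summable)
  have "(\<Sum>\<^sub>\<infinity>i\<in>\<Gamma>. \<bar>(u - w) i\<bar> powr p) = (\<Sum>\<^sub>\<infinity>i\<in>\<Gamma> - A. \<bar>(u - w) i\<bar> powr p)"
    using A eq by (intro infsum_cong_neutral) auto
  also have "\<dots> \<le> (\<Sum>\<^sub>\<infinity>i\<in>\<Gamma> - A. \<bar>x i\<bar> powr p)"
  proof (rule infsum_mono)
    show "(\<lambda>i. \<bar>(u - w) i\<bar> powr p) summable_on \<Gamma> - A"
      by (rule summable_on_subset_banach[OF s]) auto
    show "(\<lambda>i. \<bar>x i\<bar> powr p) summable_on \<Gamma> - A"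
      by (rule summable_on_subset_banach[OF lp_powr_summable[OF x]]) auto
    show "\<bar>(u - w) i\<bar> powr p \<le> \<bar>x i\<bar> powr p" for i
      using le p by (intro powr_mono2) auto
  qed
  finally have "lp_norm p \<Gamma> (u - w) < \<epsilon>" using tail lp_norm_less_iff[OF p \<epsilon>] by force
  then show "\<exists>w\<in>X. lp_norm p \<Gamma> (u - w) < \<epsilon>" using wX by blast
qed

section \<open>Reducing sets\<close>

text \<open>\<open>K\<close> ranges over all sets of the type, not only subsets of \<Gamma>, so
  complements can be taken as \<open>- K\<close> and the empty intersection \<open>UNIV\<close> is
  reducing.\<close>

definition reducing :: "('a \<Rightarrow> real) set \<Rightarrow> 'a set \<Rightarrow> bool" where
  "reducing X K \<longleftrightarrow> (\<forall>x\<in>X. (\<lambda>i. x i * indicator K i) \<in> X)"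

lemma reducing_Compl:
  assumes "fun_space.subspace X" "reducing X K"
  shows "reducing X (- K)"
proof -
  have "(\<lambda>i. x i * indicator (- K) i) = x - (\<lambda>i. x i * indicator K i)" for x :: "'a \<Rightarrow> real"
    by (auto simp: indicator_def)
  then show ?thesis
    using assms by (auto simp: reducing_def intro: fun_space.subspace_diff)
qed

lemma reducing_Int:
  assumes "reducing X K" "reducing X L"
  shows "reducing X (K \<inter> L)"
proof -
  have "(\<lambda>i. x i * indicator (K \<inter> L) i) = (\<lambda>i. x i * indicator K i * indicator L i)"
    for x :: "'a \<Rightarrow> real"
    by (auto simp: indicator_def)
  then show ?thesis using assms by (simp add: reducing_def)
qed

lemma reducing_finite_Inter:
  assumes "finite \<K>" "\<And>K. K \<in> \<K> \<Longrightarrow> reducing X K"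
  shows "reducing X (\<Inter>\<K>)"
  using assms by (induction \<K> rule: finite_induct) (auto simp: reducing_def[of X UNIV] reducing_Int)

text \<open>Each point of a finite set \<open>A\<close> outside the intersection is excluded by a
  single member of the family. Finitely many members therefore have an intersection \<open>G\<close>
  with the same trace on \<open>A\<close>, and closedness of \<open>X\<close> does the rest.\<close>

lemma reducing_Inter:
  assumes p: "p \<ge> 1" and X: "X \<subseteq> lp p \<Gamma>" "closedin (lp_topology p \<Gamma>) X"
    and \<K>: "\<And>K. K \<in> \<K> \<Longrightarrow> reducing X K"
  shows "reducing X (\<Inter>\<K>)"
  unfolding reducing_def
proof
  fix x assume x: "x \<in> X"
  then have xl: "x \<in> lp p \<Gamma>" using X by blast
  show "(\<lambda>i. x i * indicator (\<Inter>\<K>) i) \<in> X"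
  proof (rule closed_lp_memI_finite[OF p X _ xl])
    show "(\<lambda>i. x i * indicator (\<Inter>\<K>) i) \<in> lp p \<Gamma>" using xl p by (intro lp_restrict) auto
    fix A :: "'a set" assume A: "finite A"
    have "\<forall>i\<in>A - \<Inter>\<K>. \<exists>K\<in>\<K>. i \<notin> K" by blast
    then obtain F where F: "\<And>i. i \<in> A - \<Inter>\<K> \<Longrightarrow> F i \<in> \<K> \<and> i \<notin> F i" by metis
    define G where "G = \<Inter>(F ` (A - \<Inter>\<K>))"
    have "reducing X G" unfolding G_def using A F \<K> by (intro reducing_finite_Inter) auto
    then have "(\<lambda>i. x i * indicator G i) \<in> X" using x by (simp add: reducing_def)
    moreover have "\<Inter>\<K> \<subseteq> G" "A \<inter> G \<subseteq> \<Inter>\<K>" using F by (auto simp: G_def)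
    ultimately show "\<exists>w\<in>X. (\<forall>i\<in>A. w i = x i * indicator (\<Inter>\<K>) i) \<and>
        (\<forall>i. \<bar>x i * indicator (\<Inter>\<K>) i - w i\<bar> \<le> \<bar>x i\<bar>)"
      by (intro bexI[of _ "\<lambda>i. x i * indicator G i"]) (auto simp: indicator_def)
  qed
qed

section \<open>Closing off under near-best approximation\<close>

lemma near_best_approximation:
  assumes "X \<noteq> {}" "\<epsilon> > 0"
  obtains w where "w \<in> X" "\<And>v. v \<in> X \<Longrightarrow> lp_norm p \<Gamma> (a - w) \<le> lp_norm p \<Gamma> (a - v) + \<epsilon>"
proof -
  let ?D = "(\<lambda>v. lp_norm p \<Gamma> (a - v)) ` X"
  have bdd: "bdd_below ?D" by (rule bdd_belowI[of _ 0]) auto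
  have "Inf ?D < Inf ?D + \<epsilon>" using assms by simp
  then obtain w where w: "w \<in> X" "lp_norm p \<Gamma> (a - w) < Inf ?D + \<epsilon>"
    using assms bdd by (subst (asm) cInf_less_iff) auto
  moreover have "Inf ?D \<le> lp_norm p \<Gamma> (a - v)" if "v \<in> X" for v
    using bdd that by (intro cInf_lower) auto
  ultimately show ?thesis using that by force
qed

text \<open>Fix near-best approximants \<open>W a n\<close> in \<open>X\<close> with tolerance
  \<open>1 / (n + 1)\<close>. One \<open>step\<close> adds their supports for all rational vectors
  \<open>a\<close> over the current set, which preserves countability. After countably many steps
  every \<open>a\<close> over the union has its approximants supported in the union.\<close>

lemma countable_approximating_superset:
  assumes p: "p \<ge> 1" and X: "X \<subseteq> lp p \<Gamma>" "X \<noteq> {}" and J0: "countable J0" "J0 \<subseteq> \<Gamma>"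
  obtains J where "countable J" "J0 \<subseteq> J" "J \<subseteq> \<Gamma>"
    "\<And>a v \<epsilon>. a \<in> rational_vectors J \<Longrightarrow> v \<in> X \<Longrightarrow> \<epsilon> > 0 \<Longrightarrow>
      \<exists>w\<in>X \<inter> lp p J. lp_norm p \<Gamma> (a - w) \<le> lp_norm p \<Gamma> (a - v) + \<epsilon>"
proof -
  have "\<exists>w\<in>X. \<forall>v\<in>X. lp_norm p \<Gamma> (a - w) \<le> lp_norm p \<Gamma> (a - v) + inverse (Suc n)" for a n
    by (rule near_best_approximation[OF X(2), of "inverse (Suc n)" p \<Gamma> a]) auto
  then obtain W where W: "\<And>a n. W a n \<in> X"
    "\<And>a n v. v \<in> X \<Longrightarrow> lp_norm p \<Gamma> (a - W a n) \<le> lp_norm p \<Gamma> (a - v) + inverse (Suc n)"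
    by metis
  define step where "step J = J \<union> (\<Union>a\<in>rational_vectors J. \<Union>n. {i. W a n i \<noteq> 0})" for J
  define H where "H n = (step ^^ n) J0" for n
  have H_Suc: "H (Suc n) = step (H n)" for n by (simp add: H_def)
  have inc: "incseq H" by (rule incseq_SucI) (auto simp: H_Suc step_def)
  have supp: "{i. W a n i \<noteq> 0} \<subseteq> \<Gamma>" "countable {i. W a n i \<noteq> 0}" for a n
  proof -
    have "W a n \<in> lp p \<Gamma>" using W(1) X(1) by blast
    then show "{i. W a n i \<noteq> 0} \<subseteq> \<Gamma>" "countable {i. W a n i \<noteq> 0}"
      by (auto simp: lp_def intro: lp_countable_support)
  qed
  have H: "countable (H n) \<and> H n \<subseteq> \<Gamma>" for n
  proof (induction n)
    case 0
    then show ?case using J0 by (simp add: H_def)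
  next
    case (Suc n)
    then show ?case using supp
      by (auto simp: H_Suc step_def intro!: countable_UN countable_rational_vectors)
  qed
  define J where "J = (\<Union>n. H n)"
  have "J \<subseteq> \<Gamma>" using H by (auto simp: J_def)
  show ?thesis
  proof (rule that[of J])
    show "countable J" using H by (auto simp: J_def)
    have "H 0 = J0" by (simp add: H_def)
    then show "J0 \<subseteq> J" unfolding J_def by blast
    show "J \<subseteq> \<Gamma>" by fact
    fix a v and \<epsilon> :: real
    assume a: "a \<in> rational_vectors J" and v: "v \<in> X" and "\<epsilon> > 0"
    obtain m where m: "a \<in> rational_vectors (H m)"
      using a rational_vectors_UN_incseq[OF inc] by (auto simp: J_def)
    obtain n where n: "inverse (Suc n) < \<epsilon>" using reals_Archimedean[OF \<open>\<epsilon> > 0\<close>] by blast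
    \<comment> \<open>A vector available at stage \<open>m\<close> has its approximants' supports
      added at the next stage.\<close>
    have "{i. W a n i \<noteq> 0} \<subseteq> H (Suc m)" using m by (auto simp: H_Suc step_def)
    then have "{i. W a n i \<noteq> 0} \<subseteq> J" by (auto simp: J_def)
    then have "W a n \<in> lp p J"
      using W(1)[of a n] X(1) \<open>J \<subseteq> \<Gamma>\<close> by (auto simp: lp_subset_eq)
    then show "\<exists>w\<in>X \<inter> lp p J. lp_norm p \<Gamma> (a - w) \<le> lp_norm p \<Gamma> (a - v) + \<epsilon>"
      using W(1)[of a n] W(2)[OF v, of a n] n by (intro bexI[of _ "W a n"]) auto
  qed
qed

section \<open>From equal distances to reducing sets\<close>

lemma infsum_split:
  fixes f :: "'a \<Rightarrow> real"
  assumes "f summable_on S" "J \<subseteq> S"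
  shows "infsum f S = infsum f J + infsum f (S - J)"
proof -
  have "infsum f (S - J) = infsum f S - infsum f J"
    using assms by (intro infsum_Diff summable_on_subset_banach[OF assms])
  then show ?thesis by simp
qed

text \<open>
  This is where \<open>p > 1\<close> enters: moving a near-best approximation \<open>z\<close> of \<open>y = x1\<^sub>J\<close> towards \<open>x\<close>
  by the fraction \<open>t\<close> decreases the \<open>p\<close>-th power of the distance on \<open>J\<close> by order \<open>t\<close>, but
  costs only order \<open>t\<^sup>p\<close> off \<open>J\<close>.
\<close>

lemma reducing_if_approximating:
  assumes p: "p > 1" and X: "X \<subseteq> lp p \<Gamma>" "closedin (lp_topology p \<Gamma>) X"
    and sub: "fun_space.subspace X" and J: "J \<subseteq> \<Gamma>"
    and approx: "\<And>y v \<epsilon>. y \<in> lp p J \<Longrightarrow> v \<in> X \<Longrightarrow> \<epsilon> > 0 \<Longrightarrow>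
      \<exists>w\<in>X \<inter> lp p J. lp_norm p \<Gamma> (y - w) \<le> lp_norm p \<Gamma> (y - v) + \<epsilon>"
  shows "reducing X J"
  unfolding reducing_def
proof
  fix x assume x: "x \<in> X"
  have p1: "p \<ge> 1" using p by simp
  have xl: "x \<in> lp p \<Gamma>" using x X by blast
  define y where "y = (\<lambda>i. x i * indicator J i)"
  have yl: "y \<in> lp p \<Gamma>" unfolding y_def using xl p by (intro lp_restrict) auto
  have yJ: "y \<in> lp p J" using yl J by (simp add: lp_subset_eq y_def)
  \<comment> \<open>The \<open>p\<close>-th power of the norm is used because it splits additively
    over \<open>J\<close> and its complement in \<Gamma>.\<close>
  define N where "N u = (\<Sum>\<^sub>\<infinity>i\<in>\<Gamma>. \<bar>u i\<bar> powr p)" for u :: "'a \<Rightarrow> real"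
  define D where "D = Inf ((\<lambda>z. N (y - z)) ` (X \<inter> lp p J))"
  define S where "S = (\<Sum>\<^sub>\<infinity>i\<in>\<Gamma> - J. \<bar>x i\<bar> powr p)"
  have bdd: "bdd_below ((\<lambda>z. N (y - z)) ` (X \<inter> lp p J))"
    by (rule bdd_belowI[of _ 0]) (auto simp: N_def infsum_nonneg)
  have ne: "(\<lambda>z. N (y - z)) ` (X \<inter> lp p J) \<noteq> {}"
    using approx[OF yJ x, of 1] by auto
  have D_le: "D \<le> N (y - z)" if "z \<in> X \<inter> lp p J" for z
    unfolding D_def using bdd that by (intro cInf_lower) auto
  have D_less: "\<exists>z\<in>X \<inter> lp p J. N (y - z) < c" if "D < c" for c
    using that ne bdd unfolding D_def by (subst (asm) cInf_less_iff) auto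
  have N_norm: "N u = lp_norm p \<Gamma> u powr p" for u by (simp add: N_def lp_norm_powr[OF p1])
  \<comment> \<open>\<open>D\<close> is an infimum over \<open>X \<inter> lp p J\<close> only;
    \<open>approx\<close> makes it a lower bound over all of \<open>X\<close>. This matters because
    the improved approximant \<open>w\<close> below need not vanish off \<open>J\<close>. The
    tolerance is half the gap between the two distances.\<close>
  have D_le_X: "D \<le> N (y - v)" if v: "v \<in> X" for v
  proof (rule ccontr)
    assume "\<not> D \<le> N (y - v)"
    then have "lp_norm p \<Gamma> (y - v) powr p < D" by (simp add: N_norm)
    then have "(lp_norm p \<Gamma> (y - v) powr p) powr (1 / p) < D powr (1 / p)"
      using p by (intro powr_less_mono2) auto
    then have less: "lp_norm p \<Gamma> (y - v) < D powr (1 / p)" using p by (simp add: powr_powr)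
    then obtain w where w: "w \<in> X \<inter> lp p J"
        "lp_norm p \<Gamma> (y - w) \<le> lp_norm p \<Gamma> (y - v) + (D powr (1 / p) - lp_norm p \<Gamma> (y - v)) / 2"
      using approx[OF yJ v, of "(D powr (1 / p) - lp_norm p \<Gamma> (y - v)) / 2"] by auto
    then have "lp_norm p \<Gamma> (y - w) < D powr (1 / p)" using less by (simp add: field_simps)
    then have "N (y - w) < (D powr (1 / p)) powr p"
      unfolding N_norm using p by (intro powr_less_mono2) auto
    also have "\<dots> = D"
      using p le_less_trans[OF powr_ge_zero \<open>lp_norm p \<Gamma> (y - v) powr p < D\<close>]
      by (simp add: powr_powr)
    finally show False using D_le[OF w(1)] by simp
  qed
  have "D \<le> 0"
  proof (rule ccontr)
    assume "\<not> D \<le> 0"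
    then have D: "D > 0" by simp
    have S: "S \<ge> 0" by (simp add: S_def infsum_nonneg)
    have "((\<lambda>t. t powr (p - 1) * S) \<longlongrightarrow> 0 powr (p - 1) * S) (at_right (0::real))"
      using p by (intro tendsto_intros) (auto simp: eventually_at_filter)
    then have "eventually (\<lambda>t. t powr (p - 1) * S < D) (at_right 0)"
      using D by (auto intro: order_tendstoD)
    then have "eventually (\<lambda>t. t powr (p - 1) * S < D \<and> t > 0 \<and> t < 1) (at_right (0::real))"
      using eventually_at_right_less[of "0::real"] eventually_at_right_real[of 0 "1::real"]
      by (auto elim: eventually_elim2)
    then obtain t :: real where t: "t powr (p - 1) * S < D" "0 < t" "t < 1"
      using eventually_happens[of _ "at_right (0::real)"] by force
    have tp: "t powr p * S < t * D"
      using mult_strict_left_mono[OF t(1,2)] t(2) by (simp add: powr_diff)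
    \<comment> \<open>The bound exceeds \<open>D\<close> precisely because
      \<open>t powr p * S < t * D\<close>. It is the value for which
      \<open>(1 - t) * N (y - z) + t powr p * S\<close> falls below \<open>D\<close>.\<close>
    then have "D < (D - t powr p * S) / (1 - t)"
      using t by (simp add: field_simps)
    then obtain z where z: "z \<in> X" "z \<in> lp p J" "N (y - z) < (D - t powr p * S) / (1 - t)"
      using D_less by blast
    \<comment> \<open>On \<open>J\<close>, \<open>y\<close> agrees with \<open>x\<close>, so
      \<open>y - w\<close> is \<open>(1 - t)\<close> times \<open>y - z\<close>. Off
      \<open>J\<close>, both \<open>y\<close> and \<open>z\<close> vanish, so \<open>y - w\<close>
      is \<open>- t\<close> times \<open>x\<close>.\<close>
    define w where "w = (\<lambda>i. (1 - t) * z i) + (\<lambda>i. t * x i)"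
    have w: "w \<in> X" unfolding w_def
      using z x by (intro fun_space.subspace_add[OF sub] fun_space.subspace_scale[OF sub])
    have l: "y - w \<in> lp p \<Gamma>" "y - z \<in> lp p \<Gamma>"
      using lp_diff[OF p1 yl] w z X by auto
    have "N (y - w) = (\<Sum>\<^sub>\<infinity>i\<in>J. \<bar>(y - w) i\<bar> powr p) + (\<Sum>\<^sub>\<infinity>i\<in>\<Gamma> - J. \<bar>(y - w) i\<bar> powr p)"
      unfolding N_def using lp_powr_summable[OF l(1)] J by (rule infsum_split)
    also have "(\<Sum>\<^sub>\<infinity>i\<in>J. \<bar>(y - w) i\<bar> powr p) = (\<Sum>\<^sub>\<infinity>i\<in>J. (1 - t) powr p * \<bar>(y - z) i\<bar> powr p)"
    proof (rule infsum_cong)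
      fix i assume "i \<in> J"
      then have "(y - w) i = (1 - t) * (y - z) i" by (simp add: y_def w_def algebra_simps)
      then show "\<bar>(y - w) i\<bar> powr p = (1 - t) powr p * \<bar>(y - z) i\<bar> powr p"
        using t by (simp add: abs_mult powr_mult)
    qed
    also have "\<dots> = (1 - t) powr p * (\<Sum>\<^sub>\<infinity>i\<in>J. \<bar>(y - z) i\<bar> powr p)"
      by (rule infsum_cmult_right')
    also have "(\<Sum>\<^sub>\<infinity>i\<in>J. \<bar>(y - z) i\<bar> powr p) = N (y - z)"
      unfolding N_def using J yJ z(2) by (intro infsum_cong_neutral) (auto simp: lp_def)
    also have "(\<Sum>\<^sub>\<infinity>i\<in>\<Gamma> - J. \<bar>(y - w) i\<bar> powr p) = (\<Sum>\<^sub>\<infinity>i\<in>\<Gamma> - J. t powr p * \<bar>x i\<bar> powr p)"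
    proof (rule infsum_cong)
      fix i assume "i \<in> \<Gamma> - J"
      then have "(y - w) i = - (t * x i)" using z(2) by (simp add: y_def w_def lp_def)
      then show "\<bar>(y - w) i\<bar> powr p = t powr p * \<bar>x i\<bar> powr p"
        using t by (simp add: abs_mult powr_mult)
    qed
    also have "\<dots> = t powr p * S" unfolding S_def by (rule infsum_cmult_right')
    \<comment> \<open>For a base in \<open>(0, 1)\<close> and \<open>p \<ge> 1\<close>, the power is
      at most the base; the gain on \<open>J\<close> is thus at least linear in
      \<open>t\<close>.\<close>
    also have "(1 - t) powr p * N (y - z) \<le> (1 - t) * N (y - z)"
      using t p powr_mono'[of 1 p "1 - t"] by (intro mult_right_mono) (auto simp: N_norm)
    also have "(1 - t) * N (y - z) < D - t powr p * S" using z(3) t by (simp add: field_simps)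
    finally show False using D_le_X[OF w] by linarith
  qed
  \<comment> \<open>With \<open>D \<le> 0\<close> elements of \<open>X\<close> come arbitrarily
    close to \<open>y\<close>, so closedness applies.\<close>
  have "y \<in> X"
  proof (rule closed_lp_memI[OF p1 X yl])
    fix \<epsilon> :: real assume \<epsilon>: "\<epsilon> > 0"
    then have "D < \<epsilon> powr p" using \<open>D \<le> 0\<close> powr_gt_zero[of \<epsilon> p] by linarith
    then obtain z where "z \<in> X" "N (y - z) < \<epsilon> powr p" using D_less by blast
    then show "\<exists>w\<in>X. lp_norm p \<Gamma> (y - w) < \<epsilon>"
      using lp_norm_less_iff[OF p1 \<epsilon>] unfolding N_def by blast
  qed
  then show "(\<lambda>i. x i * indicator J i) \<in> X" by (simp add: y_def)
qed

text \<open>Density carries the approximation property from rational vectors to all of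
  \<open>lp p J\<close>. The tolerance is split in three: replacing \<open>y\<close> by
  \<open>a\<close>, the near-best choice for \<open>a\<close>, and returning from \<open>a\<close>
  to \<open>y\<close> in the distance to \<open>v\<close>.\<close>

lemma countable_reducing_superset:
  assumes p: "p > 1" and X: "X \<subseteq> lp p \<Gamma>" "closedin (lp_topology p \<Gamma>) X"
    and sub: "fun_space.subspace X" and J0: "countable J0" "J0 \<subseteq> \<Gamma>"
  obtains J where "countable J" "J0 \<subseteq> J" "J \<subseteq> \<Gamma>" "reducing X J"
proof -
  have p1: "p \<ge> 1" using p by simp
  have "X \<noteq> {}" using fun_space.subspace_0[OF sub] by blast
  then obtain J where J: "countable J" "J0 \<subseteq> J" "J \<subseteq> \<Gamma>" and
    approx: "\<And>a v \<epsilon>. a \<in> rational_vectors J \<Longrightarrow> v \<in> X \<Longrightarrow> \<epsilon> > 0 \<Longrightarrow>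
      \<exists>w\<in>X \<inter> lp p J. lp_norm p \<Gamma> (a - w) \<le> lp_norm p \<Gamma> (a - v) + \<epsilon>"
    using countable_approximating_superset[OF p1 X(1) _ J0] by metis
  interpret Metric_space "lp p \<Gamma>" "\<lambda>x y. lp_norm p \<Gamma> (x - y)" using p1 by (rule Metric_space_lp)
  have "reducing X J"
  proof (rule reducing_if_approximating[OF p X sub J(3)])
    fix y v and \<epsilon> :: real assume y: "y \<in> lp p J" and v: "v \<in> X" and "\<epsilon> > 0"
    then have "\<epsilon> / 3 > 0" by simp
    then obtain a where a: "a \<in> rational_vectors J" "lp_norm p \<Gamma> (y - a) < \<epsilon> / 3"
      using rational_vectors_dense[OF p1 J(3) y] by blast
    obtain w where w: "w \<in> X \<inter> lp p J" "lp_norm p \<Gamma> (a - w) \<le> lp_norm p \<Gamma> (a - v) + \<epsilon> / 3"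
      using approx[OF a(1) v \<open>\<epsilon> / 3 > 0\<close>] by blast
    have "a \<in> lp p J" using a(1) rational_vectors_subset_lp by blast
    then have mem: "y \<in> lp p \<Gamma>" "a \<in> lp p \<Gamma>" "w \<in> lp p \<Gamma>" "v \<in> lp p \<Gamma>"
      using y w v X J(3) by (auto simp: lp_subset_eq)
    have "lp_norm p \<Gamma> (y - w) \<le> lp_norm p \<Gamma> (y - v) + \<epsilon>"
      using triangle[of y a w] triangle[of a y v] commute[of a y] mem a(2) w(2) by linarith
    then show "\<exists>w\<in>X \<inter> lp p J. lp_norm p \<Gamma> (y - w) \<le> lp_norm p \<Gamma> (y - v) + \<epsilon>"
      using w(1) by blast
  qed
  then show ?thesis using that J by blast
qed

section \<open>Decomposition into minimal reducing sets\<close>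

lemma sum_fun_apply:
  fixes g :: "'b \<Rightarrow> 'a \<Rightarrow> 'c::comm_monoid_add"
  shows "(\<Sum>j\<in>F. g j) i = (\<Sum>j\<in>F. g j i)"
  by (induction F rule: infinite_finite_induct) auto

theorem proposition2p1:
  fixes p :: real and \<Gamma> :: "'a set" and X :: "('a \<Rightarrow> real) set"
  assumes "1 < p"
    and "X \<subseteq> lp p \<Gamma>" and "fun_space.subspace X" and "closedin (lp_topology p \<Gamma>) X"
  shows "\<exists>\<J> X\<^sub>J. partition_on \<Gamma> \<J> \<and>
    (\<forall>J\<in>\<J>. countable J \<and> X\<^sub>J J \<subseteq> lp p J \<and> fun_space.subspace (X\<^sub>J J)) \<and>
    X = lp_sum p \<Gamma> \<J> X\<^sub>J"
proof -
  note X = assms(2,4) and sub = assms(3)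
  have p: "p \<ge> 1" using assms(1) by simp
  define C where "C i = \<Inter>{K. reducing X K \<and> i \<in> K}" for i
  have red: "reducing X (C i)" for i
    unfolding C_def by (rule reducing_Inter[OF p X]) auto
  have self: "i \<in> C i" for i by (simp add: C_def)
  have least: "C i \<subseteq> K" if "reducing X K" "i \<in> K" for i K using that by (auto simp: C_def)
  have C: "countable (C i) \<and> C i \<subseteq> \<Gamma>" if "i \<in> \<Gamma>" for i
  proof -
    have "countable {i}" "{i} \<subseteq> \<Gamma>" using that by auto
    then obtain J where "countable J" "{i} \<subseteq> J" "J \<subseteq> \<Gamma>" "reducing X J"
      by (rule countable_reducing_superset[OF assms(1) X sub])
    then show ?thesis using least[of J i] by (auto intro: countable_subset)
  qed
  have C_eq: "C j = C i" if j: "j \<in> C i" for i j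
  \<comment> \<open>Symmetry comes from complements: if \<open>C j\<close> missed \<open>i\<close>,
    then \<open>- C j\<close> would be a reducing set containing \<open>i\<close>, hence would
    contain \<open>C i\<close> and with it \<open>j\<close>.\<close>
  proof
    show "C j \<subseteq> C i" using least[OF red j] .
    have "i \<in> C j"
    proof (rule ccontr)
      assume "i \<notin> C j"
      then have "C i \<subseteq> - C j" using reducing_Compl[OF sub red] by (intro least) auto
      then show False using j self by blast
    qed
    then show "C i \<subseteq> C j" using least[OF red] by blast
  qed
  define \<J> where "\<J> = C ` \<Gamma>"
  have disj: "J = K" if "J \<in> \<J>" "K \<in> \<J>" "i \<in> J" "i \<in> K" for J K i
  proof -
    from that(1,2) obtain a b where "J = C a" "K = C b" by (auto simp: \<J>_def)
    then show ?thesis using that C_eq[of i a] C_eq[of i b] by simp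
  qed
  have part: "partition_on \<Gamma> \<J>"
  proof (rule partition_onI)
    show "\<Union>\<J> = \<Gamma>" using C self by (auto simp: \<J>_def)
    show "disjnt J K" if "J \<in> \<J>" "K \<in> \<J>" "J \<noteq> K" for J K
      using disj[OF that(1,2)] that(3) unfolding disjnt_iff by blast
    show "{} \<notin> \<J>" using self by (auto simp: \<J>_def)
  qed
  \<comment> \<open>The component at \<open>J\<close> is the part of \<open>X\<close> living on
    \<open>J\<close>; as \<open>J\<close> is reducing, it contains \<open>x1\<^sub>J\<close> for
    every \<open>x\<close> in \<open>X\<close>.\<close>
  have "fun_space.subspace (X \<inter> lp p J)" if "J \<in> \<J>" for J
  proof -
    have "J \<subseteq> \<Gamma>" using that C by (auto simp: \<J>_def)
    then have "X \<inter> lp p J = {x \<in> X. \<forall>i. i \<notin> J \<longrightarrow> x i = 0}"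
      using X by (auto simp: lp_subset_eq)
    then show ?thesis using sub by (auto simp: fun_space.subspace_def)
  qed
  moreover have "X = lp_sum p \<Gamma> \<J> (\<lambda>J. X \<inter> lp p J)"
  proof
    show "X \<subseteq> lp_sum p \<Gamma> \<J> (\<lambda>J. X \<inter> lp p J)"
    proof
      fix x assume x: "x \<in> X"
      then have xl: "x \<in> lp p \<Gamma>" using X by blast
      have "(\<lambda>i. x i * indicator J i) \<in> X \<inter> lp p J" if "J \<in> \<J>" for J
      proof -
        have "J \<subseteq> \<Gamma>" "reducing X J" using that C red by (auto simp: \<J>_def)
        then show ?thesis
          using x X by (auto simp: lp_subset_eq reducing_def)
      qed
      moreover have "{i. x i \<noteq> 0} \<subseteq> \<Union>\<J>"
        using xl partition_onD1[OF part] by (auto simp: lp_def)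
      ultimately show "x \<in> lp_sum p \<Gamma> \<J> (\<lambda>J. X \<inter> lp p J)"
        using xl by (simp add: lp_sum_def)
    qed
    show "lp_sum p \<Gamma> \<J> (\<lambda>J. X \<inter> lp p J) \<subseteq> X"
    proof
      fix x assume "x \<in> lp_sum p \<Gamma> \<J> (\<lambda>J. X \<inter> lp p J)"
      then have xl: "x \<in> lp p \<Gamma>" and xJ: "\<And>J. J \<in> \<J> \<Longrightarrow> (\<lambda>i. x i * indicator J i) \<in> X"
        by (auto simp: lp_sum_def)
      show "x \<in> X"
      proof (rule closed_lp_memI_finite[OF p X xl xl])
        fix A assume A: "finite A" "A \<subseteq> \<Gamma>"
        define w where "w = (\<Sum>J\<in>C ` A. (\<lambda>i. x i * indicator J i))"
        have "w \<in> X" unfolding w_def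
          using A xJ by (intro fun_space.subspace_sum[OF sub]) (auto simp: \<J>_def)
        moreover have "w i = x i * indicator (\<Union>(C ` A)) i" for i
        proof -
          have "w i = (\<Sum>J\<in>C ` A. x i * indicator J i)"
            unfolding w_def by (rule sum_fun_apply)
          also have "\<dots> = x i * indicator (\<Union>(C ` A)) i"
          proof -
            have "disjoint_family_on (\<lambda>J. J) (C ` A)"
              using disj A(2) unfolding disjoint_family_on_def \<J>_def
              by (metis (no_types, lifting) disjoint_iff image_mono subsetD)
            then have "indicator (\<Union>J\<in>C ` A. J) i = (\<Sum>J\<in>C ` A. indicator J i :: real)"
              using A(1) by (intro indicator_UN_disjoint) auto
            then show ?thesis by (simp add: sum_distrib_left)
          qed
          finally show ?thesis .
        qed
        ultimately show "\<exists>w\<in>X. (\<forall>i\<in>A. w i = x i) \<and> (\<forall>i. \<bar>x i - w i\<bar> \<le> \<bar>x i\<bar>)"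
          using self by (intro bexI[of _ w]) (auto simp: indicator_def)
      qed
    qed
  qed
  ultimately show ?thesis
    using part C by (intro exI[of _ \<J>] exI[of _ "\<lambda>J. X \<inter> lp p J"]) (auto simp: \<J>_def)
qed

end
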